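(* Let $a,b,c$ be commuting indeterminates and let $D$ be the derivation of $\mathbb{Q}[a,b,c]$ determined by $D(a)=ab^2$, $D(b)=b^3c^2$, $D(c)=b^2c^3$. For $n\ge0$ let $P_n(x)=\sum_{k=0}^n\frac{(n+k)!}{(n-k)!\,k!}x^{n-k}$ (the numerator polynomial of the diagonal Padé approximant $P_n(x)/P_n(-x)$ to $e^x$). Then for all $n\ge 0$, $$D^n(ab^2)=ab^{2n+2}c^{2n}P_n\!\left(\frac{1}{c^2}\right)=ab^{2n+2}\sum_{k=0}^n\frac{(n+k)!}{(n-k)!\,k!}c^{2k}.$$
   Context: $D$ is the formal derivative of the context-free grammar $\{a\rightarrow ab^2, b\rightarrow b^3c^2, c\rightarrow b^2c^3\}$, i.e. a linear map satisfying the Leibniz rule $D(uv)=D(u)v+uD(v)$; $D^0$ is the identity. *)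

theory Defs
  imports
    "HOL-Library.Poly_Mapping"
    "HOL-Computational_Algebra.Computational_Algebra"
begin

datatype letter = A | B | C

lemma UNIV_letter: "UNIV = {A, B, C}"
  using letter.exhaust by auto

instance letter :: finite
  by standard (simp add: UNIV_letter)

text \<open>
  The order on letters has no mathematical role: the library proves that polynomials in the
  form of finitely supported functions on exponent vectors are an integral domain (needed to
  form the field of fractions) only for linearly ordered variables.
\<close>

fun letter_rank :: "letter \<Rightarrow> nat" where
  "letter_rank A = 0"
| "letter_rank B = 1"
| "letter_rank C = 2"

lemma letter_rank_inj: "letter_rank x = letter_rank y \<Longrightarrow> x = y"
  by (cases x; cases y) auto

instantiation letter :: linorder
begin

definition "x \<le> y \<longleftrightarrow> letter_rank x \<le> letter_rank y"
definition "x < y \<longleftrightarrow> letter_rank x < letter_rank y"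

instance
  by standard (auto simp: less_eq_letter_def less_letter_def intro: letter_rank_inj)

end

text \<open>
  The polynomial ring over the rationals in the three letters: a polynomial maps exponent
  vectors to coefficients, and multiplication is the library's convolution product.
\<close>

type_synonym letter_poly = "(letter \<Rightarrow>\<^sub>0 nat) \<Rightarrow>\<^sub>0 rat"

definition indet :: "letter \<Rightarrow> letter_poly" where
  "indet v = Poly_Mapping.single (Poly_Mapping.single v 1) 1"

definition const_poly :: "rat \<Rightarrow> letter_poly" where
  "const_poly q = Poly_Mapping.single 0 q"

definition derivation :: "(letter_poly \<Rightarrow> letter_poly) \<Rightarrow> bool" where
  "derivation D \<longleftrightarrow>
     (\<forall>u v. D (u + v) = D u + D v) \<and>
     (\<forall>q u. D (const_poly q * u) = const_poly q * D u) \<and>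
     (\<forall>u v. D (u * v) = D u * v + u * D v)"

definition pade_numerator :: "nat \<Rightarrow> rat poly" where
  "pade_numerator n =
     (\<Sum>k=0..n. monom (fact (n + k) / (fact (n - k) * fact k)) (n - k))"

text \<open>Value of a rational polynomial at an element of the field of fractions.\<close>

definition eval_fract :: "rat poly \<Rightarrow> letter_poly fract \<Rightarrow> letter_poly fract" where
  "eval_fract p z = poly (map_poly (\<lambda>q. to_fract (const_poly q)) p) z"

text \<open>
  A derivation exists for, and is determined by, arbitrary prescribed values on the letters.
\<close>

lemma const_poly_mult: "const_poly (p * q) = const_poly p * const_poly q"
  by (simp add: const_poly_def Poly_Mapping.mult_single)

lemma const_poly_add: "const_poly (p + q) = const_poly p + const_poly q"
  by (simp add: const_poly_def single_add)

lemma const_poly_0: "const_poly 0 = 0"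
  by (simp add: const_poly_def)

lemma letter_poly_induct [case_names add single]:
  assumes add: "\<And>p q. P p \<Longrightarrow> P q \<Longrightarrow> P (p + q)"
    and single: "\<And>m r. P (Poly_Mapping.single m r)"
  shows "P (p :: letter_poly)"
proof (induction p rule: Poly_Mapping.update_induct)
  case const
  show ?case using single[of 0 0] by simp
next
  case (update p m r)
  have "Poly_Mapping.update m r p = p + Poly_Mapping.single m r"
    using update.hyps
    by (intro poly_mapping_eqI)
      (auto simp: lookup_add lookup_update lookup_single when_def in_keys_iff)
  then show ?case using add[OF update.IH single] by simp
qed

definition deriv_monom :: "(letter \<Rightarrow> letter_poly) \<Rightarrow> (letter \<Rightarrow>\<^sub>0 nat) \<Rightarrow> letter_poly" where
  "deriv_monom g m = (\<Sum>v\<in>UNIV. of_nat (Poly_Mapping.lookup m v) *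
     Poly_Mapping.single (m - Poly_Mapping.single v 1) 1 * g v)"

definition deriv_ext :: "(letter \<Rightarrow> letter_poly) \<Rightarrow> letter_poly \<Rightarrow> letter_poly" where
  "deriv_ext g p = (\<Sum>m\<in>Poly_Mapping.keys p.
     const_poly (Poly_Mapping.lookup p m) * deriv_monom g m)"

lemma deriv_ext_superset:
  assumes "finite S" "Poly_Mapping.keys p \<subseteq> S"
  shows "deriv_ext g p = (\<Sum>m\<in>S. const_poly (Poly_Mapping.lookup p m) * deriv_monom g m)"
  unfolding deriv_ext_def using assms
  by (intro sum.mono_neutral_left) (auto simp: in_keys_iff const_poly_0)

lemma deriv_ext_add: "deriv_ext g (p + q) = deriv_ext g p + deriv_ext g q"
proof -
  let ?S = "Poly_Mapping.keys p \<union> Poly_Mapping.keys q"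
  have "deriv_ext g (p + q) =
      (\<Sum>m\<in>?S. const_poly (Poly_Mapping.lookup (p + q) m) * deriv_monom g m)"
    by (rule deriv_ext_superset) (auto dest: Poly_Mapping.keys_add[THEN subsetD])
  also have "\<dots> = deriv_ext g p + deriv_ext g q"
    by (simp add: deriv_ext_superset[of ?S p] deriv_ext_superset[of ?S q]
        lookup_add const_poly_add distrib_right sum.distrib)
  finally show ?thesis .
qed

lemma deriv_ext_single:
  "deriv_ext g (Poly_Mapping.single m r) = const_poly r * deriv_monom g m"
  by (simp add: deriv_ext_superset[of "{m}"])

lemma shift_exponent:
  fixes m n :: "letter \<Rightarrow>\<^sub>0 nat"
  shows "of_nat (Poly_Mapping.lookup m v) *
      Poly_Mapping.single (m + n - Poly_Mapping.single v 1) (1::rat) =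
    of_nat (Poly_Mapping.lookup m v) *
      Poly_Mapping.single (m - Poly_Mapping.single v 1) 1 * Poly_Mapping.single n 1"
proof (cases "Poly_Mapping.lookup m v = 0")
  case False
  then have "m + n - Poly_Mapping.single v 1 = m - Poly_Mapping.single v 1 + n"
    by (intro poly_mapping_eqI)
      (auto simp: lookup_add lookup_minus lookup_single when_def)
  then show ?thesis by (simp add: Poly_Mapping.mult_single mult.assoc)
qed simp

lemma deriv_monom_add:
  "deriv_monom g (m + n) =
     deriv_monom g m * Poly_Mapping.single n 1 + Poly_Mapping.single m 1 * deriv_monom g n"
proof -
  have "of_nat (Poly_Mapping.lookup (m + n) v) *
      Poly_Mapping.single (m + n - Poly_Mapping.single v 1) 1 * g v =
    of_nat (Poly_Mapping.lookup m v) *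
      Poly_Mapping.single (m - Poly_Mapping.single v 1) 1 * g v * Poly_Mapping.single n 1 +
    Poly_Mapping.single m 1 * (of_nat (Poly_Mapping.lookup n v) *
      Poly_Mapping.single (n - Poly_Mapping.single v 1) 1 * g v)" for v
  proof -
    have "of_nat (Poly_Mapping.lookup (m + n) v) *
        Poly_Mapping.single (m + n - Poly_Mapping.single v 1) (1::rat) =
      of_nat (Poly_Mapping.lookup m v) *
        Poly_Mapping.single (m + n - Poly_Mapping.single v 1) 1 +
      of_nat (Poly_Mapping.lookup n v) *
        Poly_Mapping.single (n + m - Poly_Mapping.single v 1) 1"
      by (simp only: lookup_add of_nat_add distrib_right add.commute[of n m])
    then show ?thesis
      by (simp only: shift_exponent distrib_left distrib_right mult_ac)
  qed
  then show ?thesis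
    by (simp add: deriv_monom_def sum.distrib sum_distrib_left sum_distrib_right)
qed

lemma single_eq_const: "Poly_Mapping.single m r = const_poly r * Poly_Mapping.single m 1"
  by (simp add: const_poly_def Poly_Mapping.mult_single)

lemma derivation_deriv_ext: "derivation (deriv_ext g)"
proof -
  have scale: "deriv_ext g (const_poly q * u) = const_poly q * deriv_ext g u" for q u
  proof (induction u rule: letter_poly_induct)
    case (single m r)
    have "const_poly q * Poly_Mapping.single m r = Poly_Mapping.single m (q * r)"
      by (simp add: const_poly_def Poly_Mapping.mult_single)
    then show ?case by (simp add: deriv_ext_single const_poly_mult mult_ac)
  qed (simp add: deriv_ext_add distrib_left)
  have leibniz_single: "deriv_ext g (Poly_Mapping.single m r * v) =
      deriv_ext g (Poly_Mapping.single m r) * v + Poly_Mapping.single m r * deriv_ext g v"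
    for m r v
  proof (induction v rule: letter_poly_induct)
    case (single n s)
    have "deriv_ext g (Poly_Mapping.single m r * Poly_Mapping.single n s) =
        const_poly r * const_poly s *
          (deriv_monom g m * Poly_Mapping.single n 1 + Poly_Mapping.single m 1 * deriv_monom g n)"
      by (simp add: Poly_Mapping.mult_single deriv_ext_single deriv_monom_add const_poly_mult)
    also have "\<dots> =
        const_poly r * deriv_monom g m * (const_poly s * Poly_Mapping.single n 1) +
        const_poly r * Poly_Mapping.single m 1 * (const_poly s * deriv_monom g n)"
      by (simp only: distrib_left mult_ac)
    finally show ?case
      by (simp only: deriv_ext_single flip: single_eq_const)
  qed (simp add: deriv_ext_add distrib_left add_ac)
  have "deriv_ext g (u * v) = deriv_ext g u * v + u * deriv_ext g v" for u v
    by (induction u rule: letter_poly_induct)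
      (simp_all add: deriv_ext_add distrib_right add_ac leibniz_single)
  then show ?thesis
    unfolding derivation_def using deriv_ext_add scale by blast
qed

lemma deriv_ext_indet: "deriv_ext g (indet v) = g v"
proof -
  have "deriv_ext g (indet v) = deriv_monom g (Poly_Mapping.single v 1)"
    by (simp add: indet_def deriv_ext_single const_poly_def)
  also have "\<dots> = (\<Sum>w\<in>UNIV. if w = v then g v else 0)"
    unfolding deriv_monom_def
    by (intro sum.cong) (auto simp: lookup_single when_def)
  finally show ?thesis by simp
qed

lemma derivation_unique:
  assumes "derivation D" "derivation E" "\<And>v. D (indet v) = E (indet v)"
  shows "D = E"
proof -
  have one: "F 1 = 0" if "derivation F" for F
  proof -
    have "F (1 * 1) = F 1 * 1 + 1 * F 1" using that unfolding derivation_def by blast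
    then show ?thesis by simp
  qed
  have monom: "D (Poly_Mapping.single m 1) = E (Poly_Mapping.single m 1)"
    for m :: "letter \<Rightarrow>\<^sub>0 nat"
  proof (induction "\<Sum>v\<in>UNIV. Poly_Mapping.lookup m v" arbitrary: m)
    case 0
    then have "m = 0" by (intro poly_mapping_eqI) simp
    then show ?case using one[OF assms(1)] one[OF assms(2)] by simp
  next
    case (Suc k)
    then have "\<exists>v. Poly_Mapping.lookup m v \<noteq> 0"
      by (metis nat.distinct(1) sum.neutral)
    then obtain v where v: "Poly_Mapping.lookup m v \<noteq> 0" ..
    define n where "n = m - Poly_Mapping.single v 1"
    have m: "m = Poly_Mapping.single v 1 + n"
      using v unfolding n_def
      by (intro poly_mapping_eqI) (auto simp: lookup_add lookup_minus lookup_single when_def)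
    have "(\<Sum>w\<in>UNIV. Poly_Mapping.lookup m w) = Suc (\<Sum>w\<in>UNIV. Poly_Mapping.lookup n w)"
      unfolding m by (simp add: lookup_add sum.distrib lookup_single when_def)
    then have IH: "D (Poly_Mapping.single n 1) = E (Poly_Mapping.single n 1)"
      using Suc by simp
    have "Poly_Mapping.single m 1 = indet v * Poly_Mapping.single n 1"
      by (simp add: m indet_def Poly_Mapping.mult_single)
    then show ?case using assms IH by (simp add: derivation_def)
  qed
  have "D p = E p" for p
  proof (induction p rule: letter_poly_induct)
    case (add p q)
    then show ?case using assms by (simp add: derivation_def)
  next
    case (single m r)
    have scale: "F (Poly_Mapping.single m r) = const_poly r * F (Poly_Mapping.single m 1)"
      if "derivation F" for F
      using that unfolding derivation_def single_eq_const[of m r] by blast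
    show ?case by (simp only: scale[OF assms(1)] scale[OF assms(2)] monom)
  qed
  then show ?thesis by blast
qed

lemma derivation_ex1: "\<exists>!D. derivation D \<and> (\<forall>v. D (indet v) = g v)"
proof (rule ex1I)
  show "derivation (deriv_ext g) \<and> (\<forall>v. deriv_ext g (indet v) = g v)"
    by (simp add: derivation_deriv_ext deriv_ext_indet)
  show "E = deriv_ext g" if "derivation E \<and> (\<forall>v. E (indet v) = g v)" for E
    using that derivation_deriv_ext by (intro derivation_unique) (simp_all add: deriv_ext_indet)
qed

end

theory Submission
  imports Defs
begin

text \<open>
  On monomials, \<open>D (a b\<^sup>2\<^sup>m c\<^sup>2\<^sup>k) = a b\<^sup>2\<^sup>m\<^sup>+\<^sup>2 (c\<^sup>2\<^sup>k + (2 m + 2 k) c\<^sup>2\<^sup>k\<^sup>+\<^sup>2)\<close>.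
  With \<open>m = n + 1\<close>, comparing coefficients turns induction on \<open>n\<close> into the recurrence
  \<open>t (n + 1, k) = t (n, k) + 2 (n + k) t (n, k - 1)\<close> for \<open>t (n, k) = (n + k)! / ((n - k)! k!)\<close>.
\<close>

lemma derivation_add: "derivation D \<Longrightarrow> D (u + v) = D u + D v"
  and derivation_scale: "derivation D \<Longrightarrow> D (const_poly q * u) = const_poly q * D u"
  and derivation_mult: "derivation D \<Longrightarrow> D (u * v) = D u * v + u * D v"
  by (auto simp: derivation_def)

lemma derivation_0: "derivation D \<Longrightarrow> D 0 = 0"
  using derivation_scale[of D 0 0] by (simp add: const_poly_0)

lemma derivation_sum: "derivation D \<Longrightarrow> D (sum f S) = (\<Sum>i\<in>S. D (f i))"
  by (induction S rule: infinite_finite_induct) (simp_all add: derivation_0 derivation_add)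

lemma derivation_power_Suc:
  assumes "derivation D"
  shows "D (u ^ Suc m) = of_nat (Suc m) * u ^ m * D u"
proof (induction m)
  case (Suc m)
  have "D (u ^ Suc (Suc m)) = D u * u ^ Suc m + u * D (u ^ Suc m)"
    using derivation_mult[OF assms, of u "u ^ Suc m"] by (simp only: power_Suc)
  also have "\<dots> = of_nat (Suc (Suc m)) * u ^ Suc m * D u"
    by (simp only: Suc.IH) (simp add: algebra_simps)
  finally show ?case .
qed simp

text \<open>With \<open>w\<close> as logarithmic derivative of \<open>u\<close>, that of
  \<open>u ^ m\<close> is \<open>of_nat m * w\<close>. In this form no exponent \<open>m - 1\<close>
  occurs, so \<open>m = 0\<close> is included.\<close>

lemma derivation_power:
  assumes "derivation D" "D u = u * w"
  shows "D (u ^ m) = of_nat m * u ^ m * w"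
proof (cases m)
  case 0
  have "D 1 = 0" using derivation_mult[OF assms(1), of 1 1] by simp
  then show ?thesis by (simp add: 0)
next
  case (Suc k)
  then show ?thesis by (simp only: derivation_power_Suc[OF assms(1)] assms(2)) (simp add: mult_ac)
qed

text \<open>The factors of the coefficient recurrence sit inside \<open>const_poly\<close>, while
  exponents brought down by a derivation appear as \<open>of_nat\<close>; this matches the
  two.\<close>

lemma const_poly_of_nat: "const_poly (of_nat m) = of_nat m"
  by (induction m) (simp_all add: const_poly_add const_poly_0, simp add: const_poly_def)

lemma map_poly_sum_monom:
  assumes "f 0 = 0" "\<And>x y. f (x + y) = f x + f y"
  shows "map_poly f (\<Sum>i\<in>S. monom (c i) (e i)) = (\<Sum>i\<in>S. monom (f (c i)) (e i))"
proof -
  have "f (sum g S) = (\<Sum>i\<in>S. f (g i))" for g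
    by (induction S rule: infinite_finite_induct) (simp_all add: assms)
  then show ?thesis
    by (intro poly_eqI) (auto simp: coeff_map_poly coeff_sum assms(1) intro!: sum.cong)
qed

lemma eval_fract_pade_numerator:
  "eval_fract (pade_numerator n) z =
     (\<Sum>k=0..n. to_fract (const_poly (fact (n + k) / (fact (n - k) * fact k))) * z ^ (n - k))"
  unfolding eval_fract_def pade_numerator_def
  by (subst map_poly_sum_monom)
    (simp_all add: const_poly_0 const_poly_add poly_sum poly_monom)

text \<open>The cutoff is explicit because \<open>n - k\<close> truncates to 0 for
  \<open>k > n\<close>, where the bare quotient would be nonzero.\<close>

definition pade_coeff :: "nat \<Rightarrow> nat \<Rightarrow> rat" where
  "pade_coeff n k = (if k \<le> n then fact (n + k) / (fact (n - k) * fact k) else 0)"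

lemma pade_coeff_Suc_0: "pade_coeff (Suc n) 0 = pade_coeff n 0"
  by (simp add: pade_coeff_def)

text \<open>
  For \<open>k < n\<close> the recurrence clears to \<open>n + k + 2 = (n - k) + 2 * (k + 1)\<close>. The case \<open>k = n\<close>
  relies on the convention that coefficients beyond \<open>n\<close> vanish.
\<close>

lemma pade_coeff_Suc_Suc:
  "pade_coeff (Suc n) (Suc k) =
     pade_coeff n (Suc k) + of_nat (2 * n + 2 + 2 * k) * pade_coeff n k"
proof -
  consider (less) "k < n" | (eq) "k = n" | (greater) "k > n" by linarith
  then show ?thesis
  proof cases
    case less
    \<comment> \<open>This removes truncated subtraction: \<open>n - k\<close> becomes
      \<open>Suc d\<close> and \<open>n - Suc k\<close> becomes \<open>d\<close>, so the factorials
      unfold.\<close>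
    then obtain d where n: "n = Suc (k + d)" using less_iff_Suc_add by auto
    show ?thesis
      using less by (simp add: pade_coeff_def n divide_simps) (simp add: algebra_simps)
  next
    case eq
    then show ?thesis
      by (simp add: pade_coeff_def divide_simps) (simp add: algebra_simps)
  qed (simp add: pade_coeff_def)
qed

lemma sum_pade_coeff_Suc:
  fixes z :: letter_poly
  shows "(\<Sum>k=0..Suc n. const_poly (pade_coeff (Suc n) k) * z ^ k) =
    (\<Sum>k=0..n. const_poly (pade_coeff n k) * (z ^ k + of_nat (2 * n + 2 + 2 * k) * z ^ Suc k))"
proof -
  let ?c = "\<lambda>k. const_poly (pade_coeff n k)" and ?r = "\<lambda>k. of_nat (2 * n + 2 + 2 * k) :: letter_poly"
  have "(\<Sum>k=0..Suc n. const_poly (pade_coeff (Suc n) k) * z ^ k) =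
      ?c 0 + (\<Sum>k=0..n. (?c (Suc k) + ?r k * ?c k) * z ^ Suc k)"
    by (simp only: sum.atLeast0_atMost_Suc_shift pade_coeff_Suc_0 pade_coeff_Suc_Suc
        const_poly_add const_poly_mult const_poly_of_nat o_def power_0 mult_1_right)
  also have "\<dots> = (?c 0 + (\<Sum>k=0..n. ?c (Suc k) * z ^ Suc k)) + (\<Sum>k=0..n. ?c k * (?r k * z ^ Suc k))"
    by (simp only: distrib_left distrib_right sum.distrib mult_ac add_ac)
  also have "?c 0 + (\<Sum>k=0..n. ?c (Suc k) * z ^ Suc k) = (\<Sum>k=0..Suc n. ?c k * z ^ k)"
    by (simp only: sum.atLeast0_atMost_Suc_shift o_def power_0 mult_1_right)
  \<comment> \<open>The top term drops out because \<open>pade_coeff n (Suc n)\<close> is 0.\<close>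
  also have "\<dots> = (\<Sum>k=0..n. ?c k * z ^ k)"
    by (simp add: pade_coeff_def const_poly_0)
  finally show ?thesis by (simp only: distrib_left sum.distrib)
qed

text \<open>Logarithmic derivatives add up over a product: the three factors contribute
  \<open>b^2\<close>, \<open>2 m b^2 c^2\<close> and \<open>2 k b^2 c^2\<close>.\<close>

lemma derivation_monomial:
  assumes "derivation D"
    and "D (indet A) = indet A * indet B ^ 2"
    and "D (indet B) = indet B ^ 3 * indet C ^ 2"
    and "D (indet C) = indet B ^ 2 * indet C ^ 3"
  shows "D (indet A * indet B ^ (2 * m) * (indet C ^ 2) ^ k) =
    indet A * indet B ^ (2 * Suc m) *
      ((indet C ^ 2) ^ k + of_nat (2 * m + 2 * k) * (indet C ^ 2) ^ Suc k)"
proof -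
  have B: "D (indet B ^ (2 * m)) = of_nat (2 * m) * indet B ^ (2 * m) * (indet B ^ 2 * indet C ^ 2)"
    by (rule derivation_power[OF assms(1)]) (simp add: assms eval_nat_numeral)
  have "D (indet C ^ 2) = indet C ^ 2 * (2 * (indet B ^ 2 * indet C ^ 2))"
    using derivation_power_Suc[OF assms(1), of "indet C" 1]
    by (simp add: assms eval_nat_numeral mult_ac)
  then have C: "D ((indet C ^ 2) ^ k) =
      of_nat k * (indet C ^ 2) ^ k * (2 * (indet B ^ 2 * indet C ^ 2))"
    by (rule derivation_power[OF assms(1)])
  show ?thesis
    unfolding derivation_mult[OF assms(1)] assms(2) B C
    by (simp add: algebra_simps power2_eq_square)
qed

lemma funpow_derivation:
  assumes "derivation D"
    and "D (indet A) = indet A * indet B ^ 2"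
    and "D (indet B) = indet B ^ 3 * indet C ^ 2"
    and "D (indet C) = indet B ^ 2 * indet C ^ 3"
  shows "(D ^^ n) (indet A * indet B ^ 2) =
    indet A * indet B ^ (2 * Suc n) * (\<Sum>k=0..n. const_poly (pade_coeff n k) * (indet C ^ 2) ^ k)"
proof (induction n)
  case 0
  show ?case by (simp add: pade_coeff_def const_poly_def)
next
  case (Suc n)
  \<comment> \<open>With the prefactor moved into the sum, each summand is a constant times a
    monomial covered by \<open>derivation_monomial\<close> with exponent parameter
    \<open>Suc n\<close>.\<close>
  have "(D ^^ Suc n) (indet A * indet B ^ 2) =
      D (\<Sum>k=0..n. const_poly (pade_coeff n k) *
        (indet A * indet B ^ (2 * Suc n) * (indet C ^ 2) ^ k))"
    by (simp only: funpow.simps o_apply Suc.IH sum_distrib_left mult_ac)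
  also have "\<dots> = indet A * indet B ^ (2 * Suc (Suc n)) * (\<Sum>k=0..n. const_poly (pade_coeff n k) *
      ((indet C ^ 2) ^ k + of_nat (2 * Suc n + 2 * k) * (indet C ^ 2) ^ Suc k))"
    by (simp only: derivation_sum[OF assms(1)] derivation_scale[OF assms(1)]
        derivation_monomial[OF assms] sum_distrib_left)
      (simp only: mult_ac)
  \<comment> \<open>The factor \<open>2 * Suc n + 2 * k\<close> is the
    \<open>2 * n + 2 + 2 * k\<close> of the recurrence, with \<open>z\<close> as
    \<open>indet C ^ 2\<close>. The sum up to \<open>Suc n\<close> must stay unsplit to
    match.\<close>
  finally show ?case by (simp add: sum_pade_coeff_Suc del: sum.cl_ivl_Suc)
qed

theorem theorem2:
  fixes D :: "letter_poly \<Rightarrow> letter_poly" and n :: nat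
  assumes "derivation D"
    and "D (indet A) = indet A * indet B ^ 2"
    and "D (indet B) = indet B ^ 3 * indet C ^ 2"
    and "D (indet C) = indet B ^ 2 * indet C ^ 3"
  shows "to_fract ((D ^^ n) (indet A * indet B ^ 2)) =
           to_fract (indet A) * to_fract (indet B) ^ (2 * n + 2) * to_fract (indet C) ^ (2 * n) *
             eval_fract (pade_numerator n) (1 / to_fract (indet C) ^ 2) \<and>
         (D ^^ n) (indet A * indet B ^ 2) =
           indet A * indet B ^ (2 * n + 2) *
             (\<Sum>k=0..n. const_poly (fact (n + k) / (fact (n - k) * fact k)) * indet C ^ (2 * k))"
proof -
  let ?q = "\<lambda>k. const_poly (fact (n + k) / (fact (n - k) * fact k))"
  have poly: "(D ^^ n) (indet A * indet B ^ 2) =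
      indet A * indet B ^ (2 * n + 2) * (\<Sum>k=0..n. ?q k * indet C ^ (2 * k))"
    by (simp add: funpow_derivation[OF assms] pade_coeff_def power_mult)
  \<comment> \<open>Its coefficient at its own exponent vector is 1. This allows division by
    \<open>c\<close> in the field of fractions.\<close>
  have "indet C \<noteq> 0"
    by (metis indet_def lookup_single_eq lookup_zero zero_neq_one)
  then have c: "to_fract (indet C) \<noteq> 0" by simp
  have power: "to_fract (u ^ m) = to_fract u ^ m" for u :: letter_poly and m
    by (induction m) simp_all
  have sum: "to_fract (sum f S) = (\<Sum>k\<in>S. to_fract (f k))" for f :: "nat \<Rightarrow> letter_poly" and S
    by (induction S rule: infinite_finite_induct) simp_all
  \<comment> \<open>Termwise, \<open>c^(2n)\<close> clears the denominator
    \<open>c^(2(n-k))\<close>; \<open>k \<le> n\<close> makes the truncated difference a true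
    one.\<close>
  have cancel: "to_fract (indet C) ^ (2 * n) * (x * (1 / to_fract (indet C) ^ 2) ^ (n - k)) =
      x * to_fract (indet C) ^ (2 * k)" if "k \<le> n" for k x
  proof -
    from that have "2 * n = 2 * k + 2 * (n - k)" by simp
    then have "to_fract (indet C) ^ (2 * n) =
        to_fract (indet C) ^ (2 * k) * (to_fract (indet C) ^ 2) ^ (n - k)"
      by (metis power_add power_mult)
    with c show ?thesis by (simp add: power_divide)
  qed
  have "to_fract (indet C) ^ (2 * n) *
      eval_fract (pade_numerator n) (1 / to_fract (indet C) ^ 2) =
      to_fract (\<Sum>k=0..n. ?q k * indet C ^ (2 * k))"
    by (simp add: eval_fract_pade_numerator sum_distrib_left sum power cancel)
  with poly show ?thesis by (simp add: power mult.assoc)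
qed

end
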